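(* If $\mu$ is a ULC probability measure on $\mathbb N^d$, then for every $S\subseteq[d]$, the marginal measure $\mu_S$ on $\mathbb N^S$ is ULC.
   Context: $\mathbb N=\{0,1,2,\dots\}$, $[d]=\{1,\dots,d\}$. For $\mathbf X\sim\mu$ and $S\subseteq[d]$, $\mu_S=\mathrm{Law}(\mathbf X_S)$, where $\mathbf X_S$ is the restriction of $\mathbf X$ to the coordinates in $S$. ULC (for a finite index set $J$, here $J=[d]$ or $J=S$): a set $T\subseteq\mathbb N^J$ is downward closed if $\mathbf n\in T$ and $\mathbf 0\le\mathbf m\le\mathbf n$ (coordinatewise) imply $\mathbf m\in T$. A probability measure $\mu$ on $\mathbb N^J$ with downward closed support is ULC (ultra-log-concave) if, with $\mathbf n!=\prod_{i\in J}n_i!$, $a(\mathbf n)=\mathbf n!\,\mu(\mathbf n)$, $\mathbf e_i$ the standard basis vectors and $\mathcal I_{\mathbf n}=\{i\in J:\mathbf n+\mathbf e_i\in\mathrm{supp}(\mu)\}$, the matrix $\big(1-\frac{a(\mathbf n)a(\mathbf n+\mathbf e_i+\mathbf e_j)}{a(\mathbf n+\mathbf e_i)a(\mathbf n+\mathbf e_j)}\big)_{i,j\in\mathcal I_{\mathbf n}}$ is positive semidefinite for every $\mathbf n\in\mathrm{supp}(\mu)$. *)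

theory Defs
  imports "HOL-Probability.Probability"
begin

text \<open>
  For a finite index set \<open>J\<close>, the set $\mathbb{N}^J$ is the extensional function space
  \<open>J \<rightarrow>\<^sub>E (UNIV :: nat set)\<close>.  As $\mathbb{N}^J$ is countable and discrete, a probability measure
  on it is a \<open>pmf\<close> whose support \<open>set_pmf\<close> lies in that function space.
\<close>

definition downward_closed :: "'i set \<Rightarrow> ('i \<Rightarrow> nat) set \<Rightarrow> bool" where
  "downward_closed J T \<longleftrightarrow>
     T \<subseteq> (J \<rightarrow>\<^sub>E UNIV) \<and>
     (\<forall>n\<in>T. \<forall>m\<in>J \<rightarrow>\<^sub>E UNIV. (\<forall>i\<in>J. m i \<le> n i) \<longrightarrow> m \<in> T)"

text \<open>The matrix \<open>A\<close> has its rows and columns indexed by the finite set \<open>I\<close>.\<close>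

definition pos_semidef_on :: "'i set \<Rightarrow> ('i \<Rightarrow> 'i \<Rightarrow> real) \<Rightarrow> bool" where
  "pos_semidef_on I A \<longleftrightarrow>
     (\<forall>i\<in>I. \<forall>j\<in>I. A i j = A j i) \<and>
     (\<forall>x :: 'i \<Rightarrow> real. 0 \<le> (\<Sum>i\<in>I. \<Sum>j\<in>I. x i * A i j * x j))"

text \<open>
  \<open>add_unit n i\<close> is $\mathbf{n} + \mathbf{e}_i$; it stays in \<open>J \<rightarrow>\<^sub>E UNIV\<close> whenever \<open>i \<in> J\<close>.
\<close>

definition add_unit :: "('i \<Rightarrow> nat) \<Rightarrow> 'i \<Rightarrow> ('i \<Rightarrow> nat)" where
  "add_unit n i = n(i := n i + 1)"

definition weight :: "'i set \<Rightarrow> ('i \<Rightarrow> nat) pmf \<Rightarrow> ('i \<Rightarrow> nat) \<Rightarrow> real" where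
  "weight J \<mu> n = (\<Prod>i\<in>J. fact (n i)) * pmf \<mu> n"

definition admissible :: "'i set \<Rightarrow> ('i \<Rightarrow> nat) pmf \<Rightarrow> ('i \<Rightarrow> nat) \<Rightarrow> 'i set" where
  "admissible J \<mu> n = {i\<in>J. add_unit n i \<in> set_pmf \<mu>}"

definition ULC :: "'i set \<Rightarrow> ('i \<Rightarrow> nat) pmf \<Rightarrow> bool" where
  "ULC J \<mu> \<longleftrightarrow>
     finite J \<and>
     set_pmf \<mu> \<subseteq> (J \<rightarrow>\<^sub>E UNIV) \<and>
     downward_closed J (set_pmf \<mu>) \<and>
     (\<forall>n\<in>set_pmf \<mu>. pos_semidef_on (admissible J \<mu> n)
        (\<lambda>i j. 1 - weight J \<mu> n * weight J \<mu> (add_unit (add_unit n i) j) /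
                   (weight J \<mu> (add_unit n i) * weight J \<mu> (add_unit n j))))"

text \<open>The law of the restriction of a \<open>\<mu>\<close>-distributed random vector to the coordinates in \<open>S\<close>.\<close>

definition marginal :: "'i set \<Rightarrow> ('i \<Rightarrow> nat) pmf \<Rightarrow> ('i \<Rightarrow> nat) pmf" where
  "marginal S \<mu> = map_pmf (\<lambda>n. restrict n S) \<mu>"

end

theory Submission
  imports Defs
begin

text \<open>
  Let \<open>f\<close> be the generating function of \<open>\<mu>\<close>, so that \<open>weight J \<mu> n\<close> is the partial derivative of
  order \<open>n\<close> of \<open>f\<close> at the origin.  Then ULC says that every partial derivative of \<open>f\<close> has a
  negative semidefinite logarithmic Hessian at the origin.  Marginalising out the coordinate \<open>k\<close>
  evaluates \<open>f\<close> at $z_k = 1$, which at $z_k = 0$ is the action of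
  $\exp(\partial_k) = \lim_M (1 + \partial_k / M)^M$.  Each factor $1 + s \partial_k$ with
  $s \ge 0$ preserves the condition by the Cauchy--Schwarz inequality, and the condition passes
  to the limit.
\<close>

section \<open>Unit shifts and quadratic forms\<close>

lemma add_unit_commute: "add_unit (add_unit n i) j = add_unit (add_unit n j) i"
  by (auto simp: add_unit_def fun_eq_iff)

definition quad_form :: "'i set \<Rightarrow> ('i \<Rightarrow> 'i \<Rightarrow> real) \<Rightarrow> ('i \<Rightarrow> real) \<Rightarrow> real" where
  "quad_form J B y = (\<Sum>i\<in>J. \<Sum>j\<in>J. y i * B i j * y j)"

lemma quad_form_add_mult:
  "quad_form J (\<lambda>i j. A i j + s * B i j) y = quad_form J A y + s * quad_form J B y"
  by (simp add: quad_form_def algebra_simps sum.distrib sum_distrib_left)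

text \<open>\<open>of_bool (i = k)\<close> is the unit vector \<open>e_k\<close>, so this expands
  the form along the line \<open>y + l e_k\<close>. Symmetry of \<open>B\<close> merges the two
  cross terms into one sum over column \<open>k\<close>.\<close>

lemma quad_form_add_axis:
  fixes y :: "'i \<Rightarrow> real"
  assumes "finite J" "k \<in> J" and sym: "\<And>i j. B i j = B j i"
  shows "quad_form J B (\<lambda>i. y i + l * of_bool (i = k)) =
    quad_form J B y + 2 * l * (\<Sum>i\<in>J. y i * B i k) + l\<^sup>2 * B k k"
proof -
  have "(\<Sum>j\<in>J. (y i + l * of_bool (i = k)) * B i j * (y j + l * of_bool (j = k))) =
      (\<Sum>j\<in>J. y i * B i j * y j) + l * (y i * B i k)
      + of_bool (i = k) * (l * (\<Sum>j\<in>J. y j * B k j) + l\<^sup>2 * B k k)" for i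
  proof -
    have "(\<Sum>j\<in>J. (y i + l * of_bool (i = k)) * B i j * (y j + l * of_bool (j = k))) =
      (\<Sum>j\<in>J. y i * B i j * y j + l * of_bool (i = k) * (B i j * y j)
         + (if j = k then (y i + l * of_bool (i = k)) * B i j * l else 0))"
      by (rule sum.cong) (auto simp: algebra_simps)
    also have "\<dots> = (\<Sum>j\<in>J. y i * B i j * y j) + l * of_bool (i = k) * (\<Sum>j\<in>J. B i j * y j)
         + (y i + l * of_bool (i = k)) * B i k * l"
      using assms(1,2) by (simp add: sum.distrib sum_distrib_left)
    finally show ?thesis
      by (auto simp: algebra_simps power2_eq_square)
  qed
  then have "quad_form J B (\<lambda>i. y i + l * of_bool (i = k)) =
      quad_form J B y + l * (\<Sum>i\<in>J. y i * B i k)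
      + (\<Sum>i\<in>J. of_bool (i = k) * (l * (\<Sum>j\<in>J. y j * B k j) + l\<^sup>2 * B k k))"
    by (simp add: quad_form_def sum.distrib sum_distrib_left)
  also have "(\<Sum>i\<in>J. of_bool (i = k) * (l * (\<Sum>j\<in>J. y j * B k j) + l\<^sup>2 * B k k)) =
      l * (\<Sum>j\<in>J. y j * B k j) + l\<^sup>2 * B k k"
    using assms(1,2) by (simp add: of_bool_def if_distrib[of "\<lambda>x. x * _"] cong: if_cong)
  also have "(\<Sum>j\<in>J. y j * B k j) = (\<Sum>j\<in>J. y j * B j k)"
    using sym by metis
  finally show ?thesis by simp
qed

section \<open>The Hessian condition and its stability under
  \<open>1 + s \<partial>_k\<close>\<close>

text \<open>The last condition is ULC with the denominators cleared.\<close>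

definition log_concave_weight :: "'i set \<Rightarrow> (('i \<Rightarrow> nat) \<Rightarrow> real) \<Rightarrow> bool" where
  "log_concave_weight J a \<longleftrightarrow>
     (\<forall>n. 0 \<le> a n) \<and>
     (\<forall>n. \<forall>i\<in>J. a n = 0 \<longrightarrow> a (add_unit n i) = 0) \<and>
     (\<forall>n y. a n * quad_form J (\<lambda>i j. a (add_unit (add_unit n i) j)) y
        \<le> (\<Sum>i\<in>J. y i * a (add_unit n i))\<^sup>2)"

text \<open>
  The first hypothesis is the Hessian condition at \<open>n\<close> for the vectors $y + l e_k$; its
  discriminant in \<open>l\<close> is what makes the cross terms nonnegative.
\<close>

lemma shifted_hessian_le:
  fixes a b c g s K Y Z :: real
  assumes quad: "\<And>l. a * (Y + 2 * l * g + l\<^sup>2 * K) \<le> (b + l * c)\<^sup>2"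
    and Z: "c * Z \<le> g\<^sup>2" and pos: "0 < a" "0 < c" "0 \<le> K" "0 \<le> s"
  shows "(a + s * c) * (Y + s * Z) \<le> (b + s * g)\<^sup>2"
proof -
  \<comment> \<open>Once the nonnegative term \<open>a * (l\<^sup>2 * K)\<close> is dropped,
    \<open>(b + l * c)\<^sup>2 - a * (Y + 2 * l * g)\<close> is a quadratic in \<open>l\<close> with
    leading coefficient \<open>c\<^sup>2\<close>; this is its minimiser.\<close>
  define l where "l = - (b * c - a * g) / c\<^sup>2"
  have lc: "l * c\<^sup>2 = - (b * c - a * g)" using pos by (simp add: l_def)
  have "0 \<le> a * (l\<^sup>2 * K)" using pos by simp
  then have "0 \<le> (b + l * c)\<^sup>2 - a * (Y + 2 * l * g)"
    using quad[of l] by (simp add: algebra_simps)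
  then have "0 \<le> c\<^sup>2 * ((b + l * c)\<^sup>2 - a * (Y + 2 * l * g))" by simp
  also have "\<dots> = c\<^sup>2 * (b\<^sup>2 - a * Y) + (l * c\<^sup>2)\<^sup>2 + 2 * (l * c\<^sup>2) * (b * c - a * g)"
    by (simp add: algebra_simps power2_eq_square)
  also have "\<dots> = c\<^sup>2 * (b\<^sup>2 - a * Y) - (b * c - a * g)\<^sup>2"
    unfolding lc by (simp add: algebra_simps power2_eq_square)
  also have "\<dots> = a * (2 * b * c * g - c\<^sup>2 * Y - a * g\<^sup>2)"
    by (simp add: algebra_simps power2_eq_square)
  finally have "0 \<le> 2 * b * c * g - c\<^sup>2 * Y - a * g\<^sup>2"
    using pos by (simp add: zero_le_mult_iff)
  moreover have "a * (c * Z) \<le> a * g\<^sup>2" using Z pos by simp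
  ultimately have "0 \<le> c * (2 * b * g - c * Y - a * Z)"
    by (simp add: algebra_simps power2_eq_square)
  \<comment> \<open>The conclusion is compared power by power in \<open>s\<close>: this is the
    first-order term, and the next two facts are the orders zero and two.\<close>
  then have "0 \<le> s * (2 * b * g - c * Y - a * Z)"
    using pos by (simp add: zero_le_mult_iff)
  moreover have "a * Y \<le> b\<^sup>2" using quad[of 0] by simp
  moreover have "s\<^sup>2 * (c * Z) \<le> s\<^sup>2 * g\<^sup>2" using Z by (simp add: mult_left_mono)
  ultimately show ?thesis by (simp add: algebra_simps power2_eq_square)
qed

text \<open>The operator \<open>1 + s \<partial>_k\<close> on generating functions, read off on
  derivatives at the origin: differentiating in \<open>z_k\<close> raises the index by
  \<open>e_k\<close>.\<close>

definition shift_add :: "real \<Rightarrow> 'i \<Rightarrow> (('i \<Rightarrow> nat) \<Rightarrow> real) \<Rightarrow> ('i \<Rightarrow> nat) \<Rightarrow> real" where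
  "shift_add s k a n = a n + s * a (add_unit n k)"

text \<open>The Hessian inequality at \<open>n\<close> in the directions \<open>y + l e_k\<close>
  and the one at \<open>n + e_k\<close> in the direction \<open>y\<close> supply the two
  inequalities that \<open>shifted_hessian_le\<close> asks for.\<close>

lemma log_concave_weight_shift_add:
  assumes a: "log_concave_weight J a" and J: "finite J" "k \<in> J" and s: "0 \<le> s"
  shows "log_concave_weight J (shift_add s k a)"
proof -
  have nonneg: "0 \<le> a n" for n
    using a by (simp add: log_concave_weight_def)
  have zero: "a n = 0 \<Longrightarrow> i \<in> J \<Longrightarrow> a (add_unit n i) = 0" for n i
    using a by (simp add: log_concave_weight_def)
  have hess: "a n * quad_form J (\<lambda>i j. a (add_unit (add_unit n i) j)) y
      \<le> (\<Sum>i\<in>J. y i * a (add_unit n i))\<^sup>2" for n y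
    using a by (simp add: log_concave_weight_def)
  have "shift_add s k a n * quad_form J (\<lambda>i j. shift_add s k a (add_unit (add_unit n i) j)) y
      \<le> (\<Sum>i\<in>J. y i * shift_add s k a (add_unit n i))\<^sup>2" for n y
  proof -
    \<comment> \<open>\<open>B\<close> and \<open>C\<close> are the second-order weights at
      \<open>n\<close> and at \<open>n + e_k\<close>, while \<open>b\<close> and \<open>g\<close>
      are the first-order ones paired with \<open>y\<close>. Row \<open>k\<close> of
      \<open>B\<close> is the first-order data at \<open>n + e_k\<close>, so \<open>g\<close> is
      also the cross term of \<open>B\<close>.\<close>
    define B where "B = (\<lambda>i j. a (add_unit (add_unit n i) j))"
    define C where "C = (\<lambda>i j. a (add_unit (add_unit (add_unit n k) i) j))"
    define b where "b = (\<Sum>i\<in>J. y i * a (add_unit n i))"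
    define g where "g = (\<Sum>i\<in>J. y i * a (add_unit (add_unit n k) i))"
    define c where "c = a (add_unit n k)"
    have C_eq: "C i j = a (add_unit (add_unit (add_unit n i) j) k)" for i j
      unfolding C_def by (metis add_unit_commute)
    have form: "quad_form J (\<lambda>i j. shift_add s k a (add_unit (add_unit n i) j)) y =
        quad_form J B y + s * quad_form J C y"
      unfolding quad_form_add_mult[symmetric] by (simp add: shift_add_def B_def C_eq)
    have lin: "(\<Sum>i\<in>J. y i * shift_add s k a (add_unit n i)) = b + s * g"
      by (simp add: shift_add_def b_def g_def algebra_simps sum.distrib sum_distrib_left
          add_unit_commute[of n k])
    have quad: "a n * (quad_form J B y + 2 * l * g + l\<^sup>2 * B k k) \<le> (b + l * c)\<^sup>2" for l
    proof -
      have "quad_form J B (\<lambda>i. y i + l * of_bool (i = k)) =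
          quad_form J B y + 2 * l * g + l\<^sup>2 * B k k"
        by (subst quad_form_add_axis[OF J]) (simp_all add: B_def g_def add_unit_commute[of n])
      moreover have "(\<Sum>i\<in>J. (y i + l * of_bool (i = k)) * a (add_unit n i)) = b + l * c"
      proof -
        have "(\<Sum>i\<in>J. (y i + l * of_bool (i = k)) * a (add_unit n i)) =
           (\<Sum>i\<in>J. y i * a (add_unit n i) + (if i = k then l * a (add_unit n i) else 0))"
          by (rule sum.cong) (auto simp: algebra_simps)
        then show ?thesis using J by (simp add: sum.distrib b_def c_def)
      qed
      ultimately show ?thesis
        using hess[of n "\<lambda>i. y i + l * of_bool (i = k)"] by (simp add: B_def)
    qed
    have Z: "c * quad_form J C y \<le> g\<^sup>2"
      using hess[of "add_unit n k" y] by (simp add: c_def C_def g_def)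
    have "(a n + s * c) * (quad_form J B y + s * quad_form J C y) \<le> (b + s * g)\<^sup>2"
    proof (cases "c = 0")
      \<comment> \<open>Vanishing spreads upwards from \<open>n + e_k\<close>, so \<open>g\<close>
        and the form of \<open>C\<close> are 0 and only the inequality at \<open>n\<close> with
        \<open>l = 0\<close> remains.\<close>
      case True
      then have "a (add_unit (add_unit n k) i) = 0" if "i \<in> J" for i
        using zero that by (simp add: c_def)
      then have "quad_form J C y = 0" "g = 0"
        by (simp_all add: quad_form_def C_def g_def zero)
      then show ?thesis using True quad[of 0] by simp
    next
      case False
      then have "a n \<noteq> 0" using zero J by (auto simp: c_def)
      then have "0 < a n" "0 < c" using False nonneg by (simp_all add: c_def less_le)
      then show ?thesis
        by (intro shifted_hessian_le[OF quad Z]) (simp_all add: B_def nonneg s)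
    qed
    then show ?thesis
      unfolding form lin by (simp add: shift_add_def c_def)
  qed
  moreover have "0 \<le> shift_add s k a n" for n
    using nonneg s by (simp add: shift_add_def)
  moreover have "shift_add s k a (add_unit n i) = 0"
    if "i \<in> J" "shift_add s k a n = 0" for n i
  proof -
    have "a n = 0"
      using that nonneg[of n] nonneg[of "add_unit n k"] s
      by (auto simp: shift_add_def add_nonneg_eq_0_iff)
    then show ?thesis using that J by (simp add: shift_add_def zero)
  qed
  ultimately show ?thesis by (simp add: log_concave_weight_def)
qed

section \<open>Powers of the shift and their exponential limit\<close>

lemma log_concave_weight_funpow_shift_add:
  assumes "log_concave_weight J a" "finite J" "k \<in> J" "0 \<le> s"
  shows "log_concave_weight J ((shift_add s k ^^ M) a)"
  using assms by (induction M) (auto intro: log_concave_weight_shift_add)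

text \<open>This is the binomial theorem for \<open>(1 + s \<partial>_k)^M\<close>; the induction
  step is Pascal's rule.\<close>

lemma funpow_shift_add:
  "(shift_add s k ^^ M) a n = (\<Sum>m\<le>M. real (M choose m) * s ^ m * a (n(k := n k + m)))"
proof (induction M arbitrary: n)
  case (Suc M)
  define b where "b m = s ^ m * a (n(k := n k + m))" for m
  have "(\<Sum>m\<le>Suc M. real (Suc M choose m) * b m) =
      b 0 + (\<Sum>m\<le>M. real (M choose Suc m) * b (Suc m)) + (\<Sum>m\<le>M. real (M choose m) * b (Suc m))"
    by (subst sum.atMost_Suc_shift) (simp add: algebra_simps sum.distrib)
  also have "b 0 + (\<Sum>m\<le>M. real (M choose Suc m) * b (Suc m)) = (\<Sum>m\<le>Suc M. real (M choose m) * b m)"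
    by (subst sum.atMost_Suc_shift) simp
  also have "\<dots> = (\<Sum>m\<le>M. real (M choose m) * b m)"
    by (simp add: binomial_eq_0)
  finally have "(\<Sum>m\<le>Suc M. real (Suc M choose m) * b m) =
      (\<Sum>m\<le>M. real (M choose m) * b m) + (\<Sum>m\<le>M. real (M choose m) * b (Suc m))" .
  moreover have "(shift_add s k ^^ Suc M) a n =
      (\<Sum>m\<le>M. real (M choose m) * b m) + (\<Sum>m\<le>M. real (M choose m) * b (Suc m))"
    unfolding funpow.simps comp_def shift_add_def[of s k "(shift_add s k ^^ M) a"] Suc
    by (simp add: b_def add_unit_def sum_distrib_left mult_ac)
  ultimately show ?case
    by (simp only: b_def mult.assoc)
qed simp

text \<open>The known limit has \<open>x^m\<close> below \<open>m + x choose x\<close>. Putting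
  \<open>M = x + m\<close> turns this denominator into \<open>(x + m)^m\<close>, and the correction
  \<open>(x / (x + m))^m\<close> tends to 1.\<close>

lemma binomial_over_power_tendsto:
  "(\<lambda>M. real (M choose m) / real (M ^ m)) \<longlonglongrightarrow> 1 / fact m"
proof (rule LIMSEQ_offset[of _ m])
  have "(\<lambda>x. 1 - real m / real (x + m)) \<longlonglongrightarrow> 1 - 0"
    by (intro tendsto_intros LIMSEQ_ignore_initial_segment[OF lim_const_over_n])
  then have "(\<lambda>x. real (m + x choose x) / real (x ^ m) * (1 - real m / real (x + m)) ^ m)
      \<longlonglongrightarrow> 1 / fact m * (1 - 0) ^ m"
    by (intro tendsto_mult tendsto_power fact_binomial_limit)
  moreover have "\<forall>\<^sub>F x in sequentially.
      real (m + x choose x) / real (x ^ m) * (1 - real m / real (x + m)) ^ m =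
      real (x + m choose m) / real ((x + m) ^ m)"
    using eventually_gt_at_top[of 0]
  proof eventually_elim
    case (elim x)
    have "1 - real m / real (x + m) = real x / real (x + m)"
      using elim by (simp add: field_simps)
    moreover have "m + x choose x = x + m choose m"
      using binomial_symmetric[of m "x + m"] by (simp add: add.commute)
    ultimately show ?case using elim by (simp add: power_divide)
  qed
  ultimately show "(\<lambda>x. real (x + m choose m) / real ((x + m) ^ m)) \<longlonglongrightarrow> 1 / fact m"
    by (simp add: Lim_transform_eventually)
qed

text \<open>For \<open>s = 1 / M\<close> the factors \<open>(M choose m) * s^m\<close> tend to
  \<open>1 / fact m\<close> and never exceed it. The series for \<open>A\<close> is thus a summable
  majorant, and Tannery's theorem gives the limit term by term.\<close>

lemma funpow_shift_add_tendsto: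
  assumes nonneg: "\<And>m. 0 \<le> a (n(k := n k + m))"
    and sums: "(\<lambda>m. a (n(k := n k + m)) / fact m) sums A"
  shows "(\<lambda>M. (shift_add (1 / real M) k ^^ M) a n) \<longlonglongrightarrow> A"
proof -
  define b where "b m = a (n(k := n k + m))" for m
  define t where "t m M = real (M choose m) / real (M ^ m) * b m" for m M
  have "(\<lambda>M. t m M) \<longlonglongrightarrow> b m / fact m" for m
    using tendsto_mult[OF binomial_over_power_tendsto[of m] tendsto_const[of "b m"]]
    by (simp add: t_def)
  moreover have "norm (t m M) \<le> b m / fact m" for m M
  proof -
    have "real (M choose m) / real (M ^ m) \<le> 1 / fact m"
    proof (cases "M ^ m = 0")
      case False
      have "real ((M choose m) * fact m) \<le> real (M ^ m)"
        using binomial_fact_pow of_nat_le_iff by blast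
      then show ?thesis using False by (simp add: field_simps)
    next
      \<comment> \<open>Here \<open>M = 0\<close> and \<open>m > 0\<close>; division by zero returns
        0, so the bound holds for every \<open>M\<close>.\<close>
      case True
      then show ?thesis by (simp only: of_nat_0 div_by_0) simp
    qed
    from mult_right_mono[OF this, of "b m"] show ?thesis
      using nonneg by (simp add: t_def b_def)
  qed
  moreover have "summable (\<lambda>m. b m / fact m)"
    using sums by (simp add: b_def sums_iff)
  ultimately have "(\<lambda>M. suminf (\<lambda>m. t m M)) \<longlonglongrightarrow> (\<Sum>m. b m / fact m)"
    by (intro tannerys_theorem[of t _ _ "\<lambda>m. b m / fact m", THEN conjunct2, THEN conjunct2]
        always_eventually) auto
  moreover have "suminf (\<lambda>m. t m M) = (shift_add (1 / real M) k ^^ M) a n" for M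
  proof -
    have "suminf (\<lambda>m. t m M) = (\<Sum>m\<le>M. t m M)"
      by (rule suminf_finite) (auto simp: t_def binomial_eq_0)
    then show ?thesis
      by (simp add: funpow_shift_add t_def b_def power_one_over field_simps)
  qed
  moreover have "(\<Sum>m. b m / fact m) = A"
    using sums by (simp add: b_def sums_iff)
  ultimately show ?thesis by simp
qed

section \<open>Equivalence of ULC with the cleared Hessian condition\<close>

lemma weight_eq_0_iff: "weight J \<mu> n = 0 \<longleftrightarrow> n \<notin> set_pmf \<mu>"
  by (cases "finite J") (auto simp: weight_def set_pmf_iff)

lemma weight_nonneg: "0 \<le> weight J \<mu> n"
  by (auto simp: weight_def intro!: mult_nonneg_nonneg prod_nonneg)

text \<open>The substitution \<open>x i = y i * weight J \<mu> (add_unit n i)\<close> turns one form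
  into the other and is invertible on the admissible indices, where these weights are nonzero. All
  other indices contribute nothing: if \<open>n + e_i\<close> is outside the support, then by
  \<open>down\<close> so is \<open>n + e_i + e_j\<close>.\<close>

lemma pos_semidef_on_iff_quad_form_le:
  assumes J: "finite J" and down: "\<And>n i. i \<in> J \<Longrightarrow> add_unit n i \<in> set_pmf \<mu> \<Longrightarrow> n \<in> set_pmf \<mu>"
  shows "pos_semidef_on (admissible J \<mu> n)
      (\<lambda>i j. 1 - weight J \<mu> n * weight J \<mu> (add_unit (add_unit n i) j) /
                 (weight J \<mu> (add_unit n i) * weight J \<mu> (add_unit n j))) \<longleftrightarrow>
    (\<forall>y. weight J \<mu> n * quad_form J (\<lambda>i j. weight J \<mu> (add_unit (add_unit n i) j)) y
        \<le> (\<Sum>i\<in>J. y i * weight J \<mu> (add_unit n i))\<^sup>2)"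
    (is "pos_semidef_on ?I ?A \<longleftrightarrow> ?R")
proof -
  let ?a = "weight J \<mu>"
  have I: "finite ?I" "?I \<subseteq> J" using J by (auto simp: admissible_def)
  have pos: "?a (add_unit n i) \<noteq> 0" if "i \<in> ?I" for i
    using that by (simp add: weight_eq_0_iff admissible_def)
  have zero: "?a (add_unit n i) = 0" if "i \<in> J - ?I" for i
    using that by (simp add: weight_eq_0_iff admissible_def)
  have zero1: "?a (add_unit (add_unit n i) j) = 0" if "i \<in> J - ?I" "j \<in> J" for i j
    using that down[of j "add_unit n i"] by (auto simp: weight_eq_0_iff admissible_def)
  have zero2: "?a (add_unit (add_unit n j) i) = 0" if "i \<in> J - ?I" "j \<in> J" for i j
    using zero1[OF that] by (simp add: add_unit_commute)
  have lin: "(\<Sum>i\<in>J. y i * ?a (add_unit n i)) = (\<Sum>i\<in>?I. y i * ?a (add_unit n i))" for y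
    using I J zero by (intro sum.mono_neutral_right) auto
  have form: "quad_form J (\<lambda>i j. ?a (add_unit (add_unit n i) j)) y =
      (\<Sum>i\<in>?I. \<Sum>j\<in>?I. y i * ?a (add_unit (add_unit n i) j) * y j)" for y
  proof -
    have "quad_form J (\<lambda>i j. ?a (add_unit (add_unit n i) j)) y =
        (\<Sum>i\<in>?I. \<Sum>j\<in>J. y i * ?a (add_unit (add_unit n i) j) * y j)"
      unfolding quad_form_def using I J zero1 by (intro sum.mono_neutral_right) auto
    also have "\<dots> = (\<Sum>i\<in>?I. \<Sum>j\<in>?I. y i * ?a (add_unit (add_unit n i) j) * y j)"
      using I J zero2 by (intro sum.cong sum.mono_neutral_right refl) auto
    finally show ?thesis .
  qed
  have key: "(\<Sum>i\<in>?I. \<Sum>j\<in>?I. x i * ?A i j * x j) =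
      (\<Sum>i\<in>J. y i * ?a (add_unit n i))\<^sup>2
        - ?a n * quad_form J (\<lambda>i j. ?a (add_unit (add_unit n i) j)) y"
    if xy: "\<And>i. i \<in> ?I \<Longrightarrow> x i = y i * ?a (add_unit n i)" for x y
  proof -
    have "(\<Sum>i\<in>?I. \<Sum>j\<in>?I. x i * ?A i j * x j) =
       (\<Sum>i\<in>?I. \<Sum>j\<in>?I. (y i * ?a (add_unit n i)) * (y j * ?a (add_unit n j))
           - ?a n * (y i * ?a (add_unit (add_unit n i) j) * y j))"
      by (intro sum.cong refl) (simp add: xy pos field_simps)
    then show ?thesis
      unfolding lin form power2_eq_square sum_product
      by (simp add: sum_subtractf sum_distrib_left)
  qed
  show ?thesis
  proof
    assume L: "pos_semidef_on ?I ?A"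
    show ?R
    proof
      fix y
      from L have "0 \<le> (\<Sum>i\<in>?I. \<Sum>j\<in>?I. (y i * ?a (add_unit n i)) * ?A i j * (y j * ?a (add_unit n j)))"
        unfolding pos_semidef_on_def by (elim conjE) (erule allE)
      then show "?a n * quad_form J (\<lambda>i j. ?a (add_unit (add_unit n i) j)) y
          \<le> (\<Sum>i\<in>J. y i * ?a (add_unit n i))\<^sup>2"
        by (subst (asm) key[of _ y]) auto
    qed
  next
    assume R: ?R
    have "0 \<le> (\<Sum>i\<in>?I. \<Sum>j\<in>?I. x i * ?A i j * x j)" for x
    proof -
      have "x i = x i / ?a (add_unit n i) * ?a (add_unit n i)" if "i \<in> ?I" for i
        using pos[OF that] by simp
      from key[OF this] R[rule_format, of "\<lambda>i. x i / ?a (add_unit n i)"] show ?thesis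
        by linarith
    qed
    then show "pos_semidef_on ?I ?A"
      unfolding pos_semidef_on_def by (auto simp: add_unit_commute mult.commute)
  qed
qed

lemma downward_closed_add_unit:
  assumes "downward_closed J T" "i \<in> J" "add_unit n i \<in> T"
  shows "n \<in> T"
proof -
  have "add_unit n i \<in> J \<rightarrow>\<^sub>E UNIV"
    using assms by (auto simp: downward_closed_def)
  \<comment> \<open>Downward closure speaks only of vectors in
    \<open>J \<rightarrow>\<^sub>E UNIV\<close>; \<open>n\<close> is one because
    \<open>i \<in> J\<close> leaves the values off \<open>J\<close> unchanged.\<close>
  then have "n \<in> J \<rightarrow>\<^sub>E UNIV"
    using assms(2) by (auto simp: PiE_def extensional_def add_unit_def fun_upd_def split: if_splits)
  moreover have "\<forall>j\<in>J. n j \<le> add_unit n i j" by (simp add: add_unit_def)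
  ultimately show ?thesis
    using assms unfolding downward_closed_def by blast
qed

text \<open>Off the support the weight is 0 and the inequality is trivial, so it may be demanded at
  every \<open>n\<close>. The vanishing condition is downward closure for a single unit
  step.\<close>

lemma ULC_iff_log_concave_weight:
  "ULC J \<mu> \<longleftrightarrow> finite J \<and> downward_closed J (set_pmf \<mu>) \<and> log_concave_weight J (weight J \<mu>)"
proof (cases "finite J \<and> downward_closed J (set_pmf \<mu>)")
  case True
  then have down: "i \<in> J \<Longrightarrow> add_unit n i \<in> set_pmf \<mu> \<Longrightarrow> n \<in> set_pmf \<mu>" for i n
    by (blast intro: downward_closed_add_unit)
  let ?P = "\<lambda>n. \<forall>y. weight J \<mu> n * quad_form J (\<lambda>i j. weight J \<mu> (add_unit (add_unit n i) j)) y
        \<le> (\<Sum>i\<in>J. y i * weight J \<mu> (add_unit n i))\<^sup>2"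
  have "ULC J \<mu> \<longleftrightarrow> (\<forall>n\<in>set_pmf \<mu>. ?P n)"
    using True by (simp add: ULC_def pos_semidef_on_iff_quad_form_le[OF _ down] downward_closed_def)
  also have "\<dots> \<longleftrightarrow> (\<forall>n. ?P n)"
  proof -
    have "?P n" if "n \<notin> set_pmf \<mu>" for n
      using that weight_eq_0_iff[of J \<mu> n] by simp
    then show ?thesis by blast
  qed
  also have "\<dots> \<longleftrightarrow> log_concave_weight J (weight J \<mu>)"
    using down by (auto simp: log_concave_weight_def weight_nonneg weight_eq_0_iff)
  finally show ?thesis using True by blast
next
  case False
  then show ?thesis by (auto simp: ULC_def)
qed

section \<open>Summing out one coordinate\<close>

lemma downward_closed_marginal:
  assumes "downward_closed J (set_pmf \<mu>)" "S \<subseteq> J"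
  shows "downward_closed S (set_pmf (marginal S \<mu>))"
  unfolding downward_closed_def
proof (intro conjI ballI impI)
  show "set_pmf (marginal S \<mu>) \<subseteq> S \<rightarrow>\<^sub>E UNIV"
    by (auto simp: marginal_def)
next
  fix n m assume n: "n \<in> set_pmf (marginal S \<mu>)" and m: "m \<in> S \<rightarrow>\<^sub>E UNIV" "\<forall>i\<in>S. m i \<le> n i"
  from n obtain p where p: "p \<in> set_pmf \<mu>" "n = restrict p S"
    by (auto simp: marginal_def)
  \<comment> \<open>Extending \<open>m\<close> by zero to \<open>J\<close> keeps it below
    \<open>p\<close>, and it restricts to \<open>m\<close> again.\<close>
  define q where "q = restrict (\<lambda>i. if i \<in> S then m i else 0) J"
  have "q \<in> J \<rightarrow>\<^sub>E UNIV" "\<forall>i\<in>J. q i \<le> p i" using m p by (auto simp: q_def)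
  then have "q \<in> set_pmf \<mu>"
    using assms p unfolding downward_closed_def by blast
  moreover have "m = restrict q S"
    using m assms by (auto simp: q_def fun_eq_iff PiE_def extensional_def)
  ultimately show "m \<in> set_pmf (marginal S \<mu>)"
    by (auto simp: marginal_def)
qed

text \<open>The support points that restrict to \<open>n\<close> have the form
  \<open>n(k := m)\<close>, and dividing by \<open>fact m\<close> removes the extra factor of the
  larger factorial product. The series is a Taylor expansion in \<open>z_k\<close> at the origin,
  evaluated at \<open>z_k = 1\<close>.\<close>

lemma weight_marginal_sums:
  assumes "finite S" "k \<notin> S" and supp: "set_pmf \<mu> \<subseteq> insert k S \<rightarrow>\<^sub>E UNIV"
    and n: "n \<in> S \<rightarrow>\<^sub>E UNIV"
  shows "(\<lambda>m. weight (insert k S) \<mu> (n(k := m)) / fact m) sums weight S (marginal S \<mu>) n"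
proof -
  define F where "F = (\<Prod>i\<in>S. fact (n i) :: real)"
  have "(\<lambda>m. pmf \<mu> (n(k := m))) sums measure \<mu> (\<Union>m. {n(k := m)})"
    unfolding measure_pmf_single[symmetric]
    by (rule measure_pmf.finite_measure_UNION)
      (auto simp: disjoint_family_on_def fun_upd_eqD dest: fun_upd_eqD)
  also have "measure \<mu> (\<Union>m. {n(k := m)}) = pmf (marginal S \<mu>) n"
    unfolding marginal_def pmf_map
  proof (rule measure_pmf.finite_measure_eq_AE)
    \<comment> \<open>The equivalence is confined to the support: a vector restricting to
      \<open>n\<close> must also be \<open>undefined\<close> off \<open>insert k S\<close> to equal
      \<open>n(k := p k)\<close>.\<close>
    have "p \<in> (\<Union>m. {n(k := m)}) \<longleftrightarrow> p \<in> (\<lambda>n. restrict n S) -` {n}" if "p \<in> set_pmf \<mu>" for p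
    proof
      assume "p \<in> (\<Union>m. {n(k := m)})"
      then show "p \<in> (\<lambda>n. restrict n S) -` {n}"
        using n assms(2) by (auto simp: PiE_def extensional_def fun_eq_iff)
    next
      assume "p \<in> (\<lambda>n. restrict n S) -` {n}"
      moreover have "p \<in> extensional (insert k S)" using supp that by (auto simp: PiE_def)
      ultimately have "p x = n x" if "x \<noteq> k" for x
        using that by (auto simp: extensional_def)
      then have "p = n(k := p k)" by auto
      then show "p \<in> (\<Union>m. {n(k := m)})" by blast
    qed
    then show "AE p in measure_pmf \<mu>. p \<in> (\<Union>m. {n(k := m)}) \<longleftrightarrow> p \<in> (\<lambda>n. restrict n S) -` {n}"
      by (simp add: AE_measure_pmf_iff)
  qed simp_all
  finally have "(\<lambda>m. F * pmf \<mu> (n(k := m))) sums (F * pmf (marginal S \<mu>) n)"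
    by (rule sums_mult)
  moreover have "(\<Prod>i\<in>S. fact ((n(k := m)) i) :: real) = F" for m
    unfolding F_def using assms(2) by (intro prod.cong) auto
  ultimately show ?thesis
    using assms(1,2) by (simp add: weight_def F_def)
qed

text \<open>The operators \<open>(1 + \<partial>_k / M)^M\<close> keep the Hessian inequality, which
  is closed under pointwise limits. The vanishing condition need not survive a limit and comes from
  the downward closed support of the marginal instead.\<close>

lemma log_concave_weight_marginal_insert:
  assumes S: "finite S" "k \<notin> S" and supp: "set_pmf \<mu> \<subseteq> insert k S \<rightarrow>\<^sub>E UNIV"
    and down: "downward_closed S (set_pmf (marginal S \<mu>))"
    and lc: "log_concave_weight (insert k S) (weight (insert k S) \<mu>)"
  shows "log_concave_weight S (weight S (marginal S \<mu>))"
proof -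
  let ?a = "weight (insert k S) \<mu>" and ?A = "weight S (marginal S \<mu>)"
  define b where "b M = (shift_add (1 / real M) k ^^ M) ?a" for M
  \<comment> \<open>For \<open>n\<close> in \<open>S \<rightarrow>\<^sub>E UNIV\<close> the value
    \<open>n k\<close> is \<open>undefined\<close>. It is reset to 0 so that the series in
    \<open>m\<close> starts at 0 and covers the whole fibre over \<open>n\<close>.\<close>
  have lim: "(\<lambda>M. b M (n(k := 0))) \<longlonglongrightarrow> ?A n" if "n \<in> S \<rightarrow>\<^sub>E UNIV" for n
    unfolding b_def
    by (rule funpow_shift_add_tendsto)
      (simp_all add: weight_nonneg weight_marginal_sums[OF S supp that])
  have hess: "?A n * quad_form S (\<lambda>i j. ?A (add_unit (add_unit n i) j)) y
        \<le> (\<Sum>i\<in>S. y i * ?A (add_unit n i))\<^sup>2" if n: "n \<in> S \<rightarrow>\<^sub>E UNIV" for n y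
  proof (rule tendsto_le[OF trivial_limit_sequentially])
    \<comment> \<open>Entry 0 at \<open>k\<close> makes the sums over \<open>insert k S\<close>
      collapse to sums over \<open>S\<close>.\<close>
    define z where "z = y(k := 0)"
    define n0 where "n0 = n(k := 0)"
    have au: "add_unit p i \<in> S \<rightarrow>\<^sub>E UNIV" if "p \<in> S \<rightarrow>\<^sub>E UNIV" "i \<in> S" for p i
      using that by (auto simp: add_unit_def PiE_def extensional_def)
    have upd: "(add_unit p i)(k := 0) = add_unit (p(k := 0)) i" if "i \<in> S" for p i
      using that S by (auto simp: add_unit_def fun_eq_iff)
    have lim1: "(\<lambda>M. b M (add_unit n0 i)) \<longlonglongrightarrow> ?A (add_unit n i)" if "i \<in> S" for i
      using lim[OF au[OF n that]] that by (simp add: upd n0_def)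
    have lim2: "(\<lambda>M. b M (add_unit (add_unit n0 i) j)) \<longlonglongrightarrow> ?A (add_unit (add_unit n i) j)"
      if "i \<in> S" "j \<in> S" for i j
      using lim[OF au[OF au[OF n that(1)] that(2)]] that by (simp add: upd n0_def)
    show "(\<lambda>M. (\<Sum>i\<in>S. y i * b M (add_unit n0 i))\<^sup>2) \<longlonglongrightarrow> (\<Sum>i\<in>S. y i * ?A (add_unit n i))\<^sup>2"
      by (intro tendsto_intros lim1)
    show "(\<lambda>M. b M n0 * quad_form S (\<lambda>i j. b M (add_unit (add_unit n0 i) j)) y)
        \<longlonglongrightarrow> ?A n * quad_form S (\<lambda>i j. ?A (add_unit (add_unit n i) j)) y"
      unfolding quad_form_def n0_def
      by (intro tendsto_intros lim[OF n] lim2[unfolded n0_def])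
    have "b M n0 * quad_form S (\<lambda>i j. b M (add_unit (add_unit n0 i) j)) y
        \<le> (\<Sum>i\<in>S. y i * b M (add_unit n0 i))\<^sup>2" for M
    proof -
      have yz: "z i = y i" if "i \<in> S" for i using that S by (auto simp: z_def)
      have z0: "z k = 0" by (simp add: z_def)
      have "log_concave_weight (insert k S) (b M)"
        unfolding b_def using S lc by (intro log_concave_weight_funpow_shift_add) auto
      then have "b M n0 * quad_form (insert k S) (\<lambda>i j. b M (add_unit (add_unit n0 i) j)) z
        \<le> (\<Sum>i\<in>insert k S. z i * b M (add_unit n0 i))\<^sup>2"
        by (simp only: log_concave_weight_def)
      then show ?thesis
        using S by (simp add: quad_form_def z0 yz cong: sum.cong)
    qed
    then show "\<forall>\<^sub>F M in sequentially. b M n0 * quad_form S (\<lambda>i j. b M (add_unit (add_unit n0 i) j)) y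
        \<le> (\<Sum>i\<in>S. y i * b M (add_unit n0 i))\<^sup>2" by simp
  qed
  have out: "?A n = 0" if "n \<notin> S \<rightarrow>\<^sub>E UNIV" for n
    using that down by (auto simp: weight_eq_0_iff downward_closed_def)
  have "?A n * quad_form S (\<lambda>i j. ?A (add_unit (add_unit n i) j)) y
        \<le> (\<Sum>i\<in>S. y i * ?A (add_unit n i))\<^sup>2" for n y
    using hess[of n y] out[of n] by (cases "n \<in> S \<rightarrow>\<^sub>E UNIV") simp_all
  then show ?thesis
    using down by (auto simp: log_concave_weight_def weight_nonneg weight_eq_0_iff
        dest: downward_closed_add_unit)
qed

lemma ULC_marginal_insert:
  assumes "ULC (insert k S) \<mu>" "k \<notin> S"
  shows "ULC S (marginal S \<mu>)"
proof -
  have *: "finite S" "downward_closed (insert k S) (set_pmf \<mu>)"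
      "log_concave_weight (insert k S) (weight (insert k S) \<mu>)"
    using assms(1) by (simp_all add: ULC_iff_log_concave_weight)
  then have "downward_closed S (set_pmf (marginal S \<mu>))"
    by (blast intro: downward_closed_marginal)
  moreover have "set_pmf \<mu> \<subseteq> insert k S \<rightarrow>\<^sub>E UNIV"
    using assms(1) by (simp add: ULC_def)
  ultimately show ?thesis
    using * assms(2) by (simp add: ULC_iff_log_concave_weight log_concave_weight_marginal_insert)
qed

section \<open>Summing out several coordinates\<close>

lemma marginal_marginal: "S \<subseteq> T \<Longrightarrow> marginal S (marginal T \<mu>) = marginal S \<mu>"
  by (simp add: marginal_def map_pmf_comp Int_absorb1)

text \<open>The coordinates in \<open>D\<close> are removed one at a time. The measure is
  generalised because the induction hypothesis is applied to the marginal on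
  \<open>D \<union> S\<close>.\<close>

lemma ULC_marginal:
  assumes "finite D" "D \<inter> S = {}" "ULC (D \<union> S) \<mu>"
  shows "ULC S (marginal S \<mu>)"
  using assms
proof (induction D arbitrary: \<mu> rule: finite_induct)
  case empty
  then have "marginal S \<mu> = \<mu>"
    unfolding marginal_def
    by (intro map_pmf_idI) (auto simp: ULC_def intro!: PiE_restrict)
  then show ?case using empty by simp
next
  case (insert k D)
  then have "ULC (D \<union> S) (marginal (D \<union> S) \<mu>)"
    by (intro ULC_marginal_insert[of k]) auto
  from insert.IH[OF _ this] insert.prems show ?case
    by (simp add: marginal_marginal)
qed

theorem propositionE4:
  fixes d :: nat and \<mu> :: "(nat \<Rightarrow> nat) pmf" and S :: "nat set"
  assumes "ULC {1..d} \<mu>"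
    and "S \<subseteq> {1..d}"
  shows "ULC S (marginal S \<mu>)"
  using assms by (intro ULC_marginal[of "{1..d} - S"]) (auto simp: Un_absorb2)

end
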